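(* Let $\Omega=(\Omega_n)_{n\in\mathbb{N}}$ be a compact continuous signature and let $\mathbf{A}=(A,E)$ be an affinely bounded topological $\Omega$-algebra. Then the following are equivalent: (1) $\mathbf{A}$ is profinite; (2) $A$ is a Stone space (a totally disconnected compact Hausdorff space).
   Context: A continuous signature is a sequence $\Omega=(\Omega_n)_{n\in\mathbb{N}}$ of pairwise disjoint topological spaces ($\Omega_n$ is the space of $n$-ary operation symbols); it is compact if every $\Omega_n$ is compact. A topological $\Omega$-algebra is a pair $\mathbf{A}=(A,E)$ where $A$ is a topological space and $E=(E_n)_{n\in\mathbb{N}}$ is a family of continuous maps $E_n\colon \Omega_n\times A^n\to A$ (product topologies). A homomorphism $\phi\colon\mathbf{A}\to\mathbf{B}$ of $\Omega$-algebras satisfies $\phi(E_n(\omega,a_1,\dots,a_n))=E^{\mathbf{B}}_n(\omega,\phi(a_1),\dots,\phi(a_n))$. $\mathbf{A}$ is profinite if $A$ is compact and for any distinct $x,y\in A$ there exist a finite discrete topological $\Omega$-algebra $\mathbf{B}$ and a continuous homomorphism $\phi\colon\mathbf{A}\to\mathbf{B}$ with $\phi(x)\neq\phi(y)$. Affine boundedness (a property of the underlying algebra): A translation of $\mathbf{A}$ is a map $A\to A$, $z\mapsto E_n(\omega,a_1,\dots,a_{i-1},z,a_{i+1},\dots,a_n)$ with $n\ge1$, $\omega\in\Omega_n$, $i\in\{1,\dots,n\}$ and fixed $a_j\in A$. The translation monoid $M(\mathbf{A})$ is the submonoid of $(A^A,\circ)$ generated by all translations. Assume $A$ is disjoint from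 all $\Omega_n$, and let $\Omega+A$ be the signature whose nullary symbols are $\Omega_0\cup A$ and whose $n$-ary symbols are $\Omega_n$ for $n\ge1$. Consider terms over $\Omega+A$ in one variable $x$ (written $\omega t_1\dots t_n$). Height: $\mathrm{h}(x)=0$, $\mathrm{h}(c)=0$ for nullary symbols $c$, $\mathrm{h}(\omega t_1\dots t_n)=\max_i \mathrm{h}(t_i)+1$ for $n\ge1$. Arity: $\mathrm{ar}(x)=0$, $\mathrm{ar}(\omega t_1\dots t_n)=\max(\{\mathrm{ar}(t_i)\}_{i}\cup\{n\})$. Let $L^{\times}_{\Omega+A}(x)$ be the set of such terms in which $x$ occurs exactly once. For a term $t$, $\Psi_{\mathbf{A}}(t)\colon A\to A$ is the induced function ($x$ evaluates to the argument $z$, a constant $a\in A$ to $a$, and $\omega\in\Omega_n$ via $E_n(\omega,\cdot)$). $\mathbf{A}$ is affinely bounded by $m\in\mathbb{N}$ if $M(\mathbf{A})=\{\Psi_{\mathbf{A}}(t)\mid t\in L^{\times}_{\Omega+A}(x),\ \mathrm{ar}(t)\le m,\ \mathrm{h}(t)\le m\}$, and affinely bounded if it is affinely bounded by some $m$. *)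

theory Defs
  imports "HOL-Analysis.Analysis"
begin

definition continuous_signature :: "(nat \<Rightarrow> 'o topology) \<Rightarrow> bool" where
  "continuous_signature \<Omega> \<longleftrightarrow> disjoint_family (\<lambda>n. topspace (\<Omega> n))"

definition compact_signature :: "(nat \<Rightarrow> 'o topology) \<Rightarrow> bool" where
  "compact_signature \<Omega> \<longleftrightarrow> (\<forall>n. compact_space (\<Omega> n))"

text \<open>
  An \<open>n\<close>-tuple over \<open>A\<close> is an element of \<open>{..<n} \<rightarrow>\<^sub>E A\<close>, i.e. it is indexed from \<open>0\<close>
  and is undefined outside \<open>{..<n}\<close>.
\<close>

abbreviation power_topology :: "'a topology \<Rightarrow> nat \<Rightarrow> (nat \<Rightarrow> 'a) topology" where
  "power_topology A n \<equiv> product_topology (\<lambda>_. A) {..<n}"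

type_synonym ('o, 'a) ops = "nat \<Rightarrow> 'o \<Rightarrow> (nat \<Rightarrow> 'a) \<Rightarrow> 'a"

definition topological_algebra ::
    "(nat \<Rightarrow> 'o topology) \<Rightarrow> 'a topology \<Rightarrow> ('o, 'a) ops \<Rightarrow> bool" where
  "topological_algebra \<Omega> A E \<longleftrightarrow>
     (\<forall>n. continuous_map (prod_topology (\<Omega> n) (power_topology A n)) A (\<lambda>(\<omega>, a). E n \<omega> a))"

definition algebra_hom ::
    "(nat \<Rightarrow> 'o topology) \<Rightarrow> 'a set \<Rightarrow> ('o, 'a) ops \<Rightarrow> 'b set \<Rightarrow> ('o, 'b) ops \<Rightarrow> ('a \<Rightarrow> 'b) \<Rightarrow> bool"
  where
  "algebra_hom \<Omega> A E B F \<phi> \<longleftrightarrow>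
     \<phi> \<in> A \<rightarrow> B \<and>
     (\<forall>n. \<forall>\<omega>\<in>topspace (\<Omega> n). \<forall>a\<in>{..<n} \<rightarrow>\<^sub>E A.
        \<phi> (E n \<omega> a) = F n \<omega> (\<lambda>i\<in>{..<n}. \<phi> (a i)))"

text \<open>
  The finite discrete algebras range over carriers that are finite sets of natural numbers. This
  is no restriction: by the lemma \<open>finite_discrete_algebra_nat\<close> below, every finite discrete
  algebra, on a carrier of any type, can be replaced by such a one.
\<close>

definition profinite_algebra ::
    "(nat \<Rightarrow> 'o topology) \<Rightarrow> 'a topology \<Rightarrow> ('o, 'a) ops \<Rightarrow> bool" where
  "profinite_algebra \<Omega> A E \<longleftrightarrow>
     compact_space A \<and>
     (\<forall>x\<in>topspace A. \<forall>y\<in>topspace A. x \<noteq> y \<longrightarrow>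
        (\<exists>(B :: nat set) F \<phi>.
           finite B \<and> topological_algebra \<Omega> (discrete_topology B) F \<and>
           continuous_map A (discrete_topology B) \<phi> \<and>
           algebra_hom \<Omega> (topspace A) E B F \<phi> \<and> \<phi> x \<noteq> \<phi> y))"

lemma finite_discrete_algebra_nat:
  fixes S :: "'b set" and A :: "'a topology"
  assumes fin: "finite S"
    and alg: "topological_algebra \<Omega> (discrete_topology S) G"
    and cont: "continuous_map A (discrete_topology S) \<psi>"
    and hom: "algebra_hom \<Omega> (topspace A) E S G \<psi>"
    and xy: "x \<in> topspace A" "y \<in> topspace A" "\<psi> x \<noteq> \<psi> y"
  shows "\<exists>(B :: nat set) F \<phi>.
           finite B \<and> topological_algebra \<Omega> (discrete_topology B) F \<and>
           continuous_map A (discrete_topology B) \<phi> \<and>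
           algebra_hom \<Omega> (topspace A) E B F \<phi> \<and> \<phi> x \<noteq> \<phi> y"
proof -
  obtain h :: "'b \<Rightarrow> nat" where h: "bij_betw h S {0..<card S}"
    using ex_bij_betw_finite_nat[OF fin] by blast
  define B where "B = h ` S"
  define g where "g = inv_into S h"
  define F where "F = (\<lambda>n \<omega> b. h (G n \<omega> (\<lambda>i\<in>{..<n}. g (b i))))"
  have inj: "inj_on h S"
    using h by (rule bij_betw_imp_inj_on)
  have gh: "g (h s) = s" if "s \<in> S" for s
    using that inj by (simp add: g_def)
  have conth: "continuous_map (discrete_topology S) (discrete_topology B) h"
    by (simp add: B_def)
  have contg: "continuous_map (discrete_topology B) (discrete_topology S) g"
    using gh by (auto simp: B_def)
  have "continuous_map (prod_topology (\<Omega> n) (power_topology (discrete_topology B) n))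
          (discrete_topology B) (\<lambda>(\<omega>, b). F n \<omega> b)" for n
  proof -
    let ?P = "prod_topology (\<Omega> n) (power_topology (discrete_topology B) n)"
    have comp: "continuous_map ?P (discrete_topology S) (\<lambda>p. g (snd p i))" if "i < n" for i
    proof -
      have "continuous_map ?P (power_topology (discrete_topology B) n) snd"
        by (rule continuous_map_snd)
      then have "continuous_map ?P (discrete_topology B) (\<lambda>p. snd p i)"
        using that by (simp add: continuous_map_componentwise)
      from continuous_map_compose[OF this contg] show ?thesis
        by (simp add: o_def)
    qed
    have "continuous_map ?P (prod_topology (\<Omega> n) (power_topology (discrete_topology S) n))
            (\<lambda>p. (fst p, \<lambda>i\<in>{..<n}. g (snd p i)))"
    proof (rule continuous_map_pairedI)
      show "continuous_map ?P (\<Omega> n) fst"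
        by (rule continuous_map_fst)
      show "continuous_map ?P (power_topology (discrete_topology S) n)
              (\<lambda>p. \<lambda>i\<in>{..<n}. g (snd p i))"
        using comp by (auto simp: continuous_map_componentwise)
    qed
    then have "continuous_map ?P (discrete_topology S)
        ((\<lambda>(\<omega>, a). G n \<omega> a) \<circ> (\<lambda>p. (fst p, \<lambda>i\<in>{..<n}. g (snd p i))))"
      by (rule continuous_map_compose) (use alg in \<open>simp add: topological_algebra_def\<close>)
    then have "continuous_map ?P (discrete_topology B)
        (h \<circ> ((\<lambda>(\<omega>, a). G n \<omega> a) \<circ> (\<lambda>p. (fst p, \<lambda>i\<in>{..<n}. g (snd p i)))))"
      using conth by (rule continuous_map_compose)
    moreover have "h \<circ> ((\<lambda>(\<omega>, a). G n \<omega> a) \<circ> (\<lambda>p. (fst p, \<lambda>i\<in>{..<n}. g (snd p i))))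
        = (\<lambda>(\<omega>, b). F n \<omega> b)"
      by (auto simp: F_def)
    ultimately show ?thesis
      by simp
  qed
  then have 1: "topological_algebra \<Omega> (discrete_topology B) F"
    by (simp add: topological_algebra_def)
  have 2: "continuous_map A (discrete_topology B) (h \<circ> \<psi>)"
    using cont conth by (rule continuous_map_compose)
  have psi: "\<psi> z \<in> S" if "z \<in> topspace A" for z
    using hom that by (auto simp: algebra_hom_def)
  have 3: "algebra_hom \<Omega> (topspace A) E B F (h \<circ> \<psi>)"
    unfolding algebra_hom_def
  proof (intro conjI allI ballI)
    show "h \<circ> \<psi> \<in> topspace A \<rightarrow> B"
      using psi by (auto simp: B_def)
  next
    fix n \<omega> a
    assume *: "\<omega> \<in> topspace (\<Omega> n)" "a \<in> {..<n} \<rightarrow>\<^sub>E topspace A"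
    have "(\<lambda>i\<in>{..<n}. g ((\<lambda>i\<in>{..<n}. (h \<circ> \<psi>) (a i)) i)) = (\<lambda>i\<in>{..<n}. \<psi> (a i))"
      using *(2) by (intro restrict_ext) (auto intro!: gh psi)
    then show "(h \<circ> \<psi>) (E n \<omega> a) = F n \<omega> (\<lambda>i\<in>{..<n}. (h \<circ> \<psi>) (a i))"
      using hom * by (simp add: F_def algebra_hom_def)
  qed
  have 4: "(h \<circ> \<psi>) x \<noteq> (h \<circ> \<psi>) y"
    using xy psi inj by (auto dest: inj_onD)
  have "finite B"
    using fin by (simp add: B_def)
  with 1 2 3 4 show ?thesis
    by blast
qed

definition totally_disconnected_space :: "'a topology \<Rightarrow> bool" where
  "totally_disconnected_space X \<longleftrightarrow> (\<forall>S. connectedin X S \<longrightarrow> (\<exists>a. S \<subseteq> {a}))"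

definition Stone_space :: "'a topology \<Rightarrow> bool" where
  "Stone_space X \<longleftrightarrow> totally_disconnected_space X \<and> compact_space X \<and> Hausdorff_space X"

text \<open>
  Self-maps of a set \<open>A\<close> are elements of \<open>A \<rightarrow>\<^sub>E A\<close>, so that equality of maps is equality on \<open>A\<close>.
  The \<open>i\<close>-th entry of \<open>a\<close> below is vacant and gets filled with \<open>z\<close>.
\<close>

definition translation_maps :: "(nat \<Rightarrow> 'o topology) \<Rightarrow> 'a set \<Rightarrow> ('o, 'a) ops \<Rightarrow> ('a \<Rightarrow> 'a) set" where
  "translation_maps \<Omega> A E =
     {\<lambda>z\<in>A. E n \<omega> (a(i := z)) | n \<omega> i a.
        n \<ge> 1 \<and> \<omega> \<in> topspace (\<Omega> n) \<and> i < n \<and> a \<in> {..<n} - {i} \<rightarrow>\<^sub>E A}"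

inductive_set translation_monoid ::
    "(nat \<Rightarrow> 'o topology) \<Rightarrow> 'a set \<Rightarrow> ('o, 'a) ops \<Rightarrow> ('a \<Rightarrow> 'a) set"
  for \<Omega> :: "nat \<Rightarrow> 'o topology" and A :: "'a set" and E :: "('o, 'a) ops" where
  translation_monoid_one: "(\<lambda>z\<in>A. z) \<in> translation_monoid \<Omega> A E"
| translation_monoid_gen: "f \<in> translation_maps \<Omega> A E \<Longrightarrow> f \<in> translation_monoid \<Omega> A E"
| translation_monoid_mult: "f \<in> translation_monoid \<Omega> A E \<Longrightarrow> g \<in> translation_monoid \<Omega> A E \<Longrightarrow>
         compose A f g \<in> translation_monoid \<Omega> A E"

text \<open>
  Terms over \<open>\<Omega> + A\<close> in one variable. The separate constructor for the constants from \<open>A\<close> makes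
  them distinct from the symbols in \<open>\<Omega>\<close>; the nullary symbols from \<open>\<Omega>\<close> are \<open>Op \<omega> []\<close>.
\<close>

datatype ('o, 'a) aterm = Var | Const 'a | Op 'o "('o, 'a) aterm list"

fun wf_term :: "(nat \<Rightarrow> 'o topology) \<Rightarrow> 'a set \<Rightarrow> ('o, 'a) aterm \<Rightarrow> bool" where
  "wf_term \<Omega> A Var \<longleftrightarrow> True"
| "wf_term \<Omega> A (Const a) \<longleftrightarrow> a \<in> A"
| "wf_term \<Omega> A (Op \<omega> ts) \<longleftrightarrow>
     \<omega> \<in> topspace (\<Omega> (length ts)) \<and> (\<forall>t\<in>set ts. wf_term \<Omega> A t)"

primrec term_height :: "('o, 'a) aterm \<Rightarrow> nat" where
  "term_height Var = 0"
| "term_height (Const a) = 0"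
| "term_height (Op \<omega> ts) = (if ts = [] then 0 else Max (set (map term_height ts)) + 1)"

primrec term_arity :: "('o, 'a) aterm \<Rightarrow> nat" where
  "term_arity Var = 0"
| "term_arity (Const a) = 0"
| "term_arity (Op \<omega> ts) = Max (set (map term_arity ts) \<union> {length ts})"

primrec var_occurrences :: "('o, 'a) aterm \<Rightarrow> nat" where
  "var_occurrences Var = 1"
| "var_occurrences (Const a) = 0"
| "var_occurrences (Op \<omega> ts) = sum_list (map var_occurrences ts)"

definition linear_terms ::
    "(nat \<Rightarrow> 'o topology) \<Rightarrow> 'a set \<Rightarrow> ('o, 'a) aterm set" where
  "linear_terms \<Omega> A = {t. wf_term \<Omega> A t \<and> var_occurrences t = 1}"

primrec term_eval :: "('o, 'a) ops \<Rightarrow> 'a \<Rightarrow> ('o, 'a) aterm \<Rightarrow> 'a" where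
  "term_eval E z Var = z"
| "term_eval E z (Const a) = a"
| "term_eval E z (Op \<omega> ts) =
     E (length ts) \<omega> (\<lambda>i\<in>{..<length ts}. map (term_eval E z) ts ! i)"

definition term_function :: "'a set \<Rightarrow> ('o, 'a) ops \<Rightarrow> ('o, 'a) aterm \<Rightarrow> 'a \<Rightarrow> 'a" where
  "term_function A E t = (\<lambda>z\<in>A. term_eval E z t)"

definition affinely_bounded_by ::
    "(nat \<Rightarrow> 'o topology) \<Rightarrow> 'a set \<Rightarrow> ('o, 'a) ops \<Rightarrow> nat \<Rightarrow> bool" where
  "affinely_bounded_by \<Omega> A E m \<longleftrightarrow>
     translation_monoid \<Omega> A E =
       {term_function A E t | t. t \<in> linear_terms \<Omega> A \<and> term_arity t \<le> m \<and> term_height t \<le> m}"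

definition affinely_bounded ::
    "(nat \<Rightarrow> 'o topology) \<Rightarrow> 'a set \<Rightarrow> ('o, 'a) ops \<Rightarrow> bool" where
  "affinely_bounded \<Omega> A E \<longleftrightarrow> (\<exists>m. affinely_bounded_by \<Omega> A E m)"

end

theory Submission
  imports Defs
begin

text \<open>
  For a clopen set \<open>U\<close>, let \<open>a \<sim> b\<close> iff no map in the translation monoid separates \<open>a\<close> from
  \<open>b\<close> modulo \<open>U\<close>. This is a congruence, and if its classes are open then by compactness the
  quotient is a finite discrete algebra. To see that they are open, start from the partition
  \<open>{U, A - U}\<close> and repeatedly refine it by identifying only points that are not separated by
  any translation of arity at most \<open>m\<close>. Compactness of the spaces \<open>\<Omega>\<^sub>n \<times> A\<^sup>n\<close> and
  the tube lemma keep the classes open at each step, and \<open>m\<close> steps take care of all terms of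
  height at most \<open>m\<close>, hence, by affine boundedness, of the whole translation monoid.
\<close>

section \<open>Equivalence relations with open classes\<close>

definition open_equiv :: "'a topology \<Rightarrow> ('a \<times> 'a) set \<Rightarrow> bool" where
  "open_equiv X R \<longleftrightarrow> equiv (topspace X) R \<and> (\<forall>a\<in>topspace X. openin X (R `` {a}))"

text \<open>A class is also the class of each of its points, so it is enough to find, for every
  \<open>a\<close>, one neighbourhood inside the class named by \<open>a\<close>.\<close>

lemma open_equivI:
  assumes eq: "equiv (topspace X) R"
    and nbhd: "\<And>a. a \<in> topspace X \<Longrightarrow> \<exists>N. openin X N \<and> a \<in> N \<and> N \<subseteq> R `` {a}"
  shows "open_equiv X R"
  unfolding open_equiv_def
proof (intro conjI ballI eq)
  fix a assume "a \<in> topspace X"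
  show "openin X (R `` {a})"
  proof (subst openin_subopen, intro ballI)
    fix b assume b: "b \<in> R `` {a}"
    then have "R `` {a} = R `` {b}" "b \<in> topspace X"
      using equiv_class_eq[OF eq] equiv_type[OF eq] by auto
    with nbhd[of b] show "\<exists>N. openin X N \<and> b \<in> N \<and> N \<subseteq> R `` {a}"
      by simp
  qed
qed

text \<open>Openness passes to coarser equivalences, since the \<open>S\<close>-class of a point is
  a neighbourhood inside its \<open>R\<close>-class. Hence a congruence that is not open by
  construction can be handled through any open refinement.\<close>

lemma open_equiv_superset:
  assumes "open_equiv X S" "equiv (topspace X) R" "S \<subseteq> R"
  shows "open_equiv X R"
proof (rule open_equivI)
  fix a assume "a \<in> topspace X"
  then show "\<exists>N. openin X N \<and> a \<in> N \<and> N \<subseteq> R `` {a}"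
    using assms unfolding open_equiv_def
    by (intro exI[of _ "S `` {a}"]) (auto simp: equiv_def refl_on_def)
qed (fact assms)

lemma open_equiv_clopen:
  assumes "openin X U" "closedin X U"
  shows "open_equiv X {(a, b). a \<in> topspace X \<and> b \<in> topspace X \<and> (a \<in> U \<longleftrightarrow> b \<in> U)}"
proof (rule open_equivI)
  fix a assume a: "a \<in> topspace X"
  have "openin X (topspace X - U)"
    using assms(2) by blast
  then show "\<exists>N. openin X N \<and> a \<in> N \<and> N \<subseteq>
      {(a, b). a \<in> topspace X \<and> b \<in> topspace X \<and> (a \<in> U \<longleftrightarrow> b \<in> U)} `` {a}"
    using a assms(1) openin_subset[OF assms(1)]
    by (intro exI[of _ "if a \<in> U then U else topspace X - U"]) auto
qed (auto intro!: equivI refl_onI symI transI)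

lemma open_equiv_Int:
  assumes "open_equiv X R" "open_equiv X S"
  shows "open_equiv X (R \<inter> S)"
proof (rule open_equivI)
  show "equiv (topspace X) (R \<inter> S)"
    using assms unfolding open_equiv_def equiv_def refl_on_def
    by (auto intro: sym_Int trans_Int)
  fix a assume "a \<in> topspace X"
  then show "\<exists>N. openin X N \<and> a \<in> N \<and> N \<subseteq> (R \<inter> S) `` {a}"
    using assms unfolding open_equiv_def
    by (intro exI[of _ "R `` {a} \<inter> S `` {a}"]) (auto simp: equiv_def refl_on_def)
qed

text \<open>The separate factor \<open>R\<close> keeps the case of an empty \<open>I\<close>
  correct, where the indexed intersection alone would be \<open>UNIV\<close>.\<close>

lemma open_equiv_INT:
  assumes "finite I" "open_equiv X R" "\<And>i. i \<in> I \<Longrightarrow> open_equiv X (S i)"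
  shows "open_equiv X (R \<inter> (\<Inter>i\<in>I. S i))"
  using assms(1,3)
proof (induction I rule: finite_induct)
  case empty
  then show ?case using assms(2) by simp
next
  case (insert i I)
  then have "open_equiv X (S i \<inter> (R \<inter> (\<Inter>i\<in>I. S i)))"
    by (simp add: open_equiv_Int)
  then show ?case
    by (simp add: Int_left_commute)
qed

text \<open>The pairs \<open>(k, b)\<close> for which \<open>g (k, b)\<close> and
  \<open>g (k, a)\<close> lie in one class form an open set containing the slice over
  \<open>a\<close>. Compactness of \<open>K\<close> puts a whole tube around that slice into it, so
  \<open>N\<close> does not depend on \<open>k\<close>.\<close>

lemma open_equiv_tube:
  assumes R: "open_equiv Y R" and K: "compact_space K"
    and g: "continuous_map (prod_topology K X) Y g" and a: "a \<in> topspace X"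
  shows "\<exists>N. openin X N \<and> a \<in> N \<and> (\<forall>b\<in>N. \<forall>k\<in>topspace K. (g (k, a), g (k, b)) \<in> R)"
proof -
  have eq: "equiv (topspace Y) R" and op: "\<And>z. z \<in> topspace Y \<Longrightarrow> openin Y (R `` {z})"
    using R by (auto simp: open_equiv_def)
  let ?P = "prod_topology K X"
  have "continuous_map ?P Y (g \<circ> (\<lambda>p. (fst p, a)))"
    by (rule continuous_map_compose[OF _ g])
      (use a in \<open>auto intro!: continuous_map_pairedI continuous_map_fst\<close>)
  then have ga: "continuous_map ?P Y (\<lambda>p. g (fst p, a))"
    by (simp add: o_def)
  have gY: "g p \<in> topspace Y" if "p \<in> topspace ?P" for p
    using continuous_map_funspace[OF g] that by auto
  \<comment> \<open>Writing "same class" as a union over the possible classes exhibits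
    \<open>W\<close> as a union of intersections of two open preimages.\<close>
  define W where "W = (\<Union>z\<in>topspace Y. {p \<in> topspace ?P. g p \<in> R `` {z}} \<inter>
      {p \<in> topspace ?P. g (fst p, a) \<in> R `` {z}})"
  have "openin ?P W"
    unfolding W_def using op openin_continuous_map_preimage[OF g]
      openin_continuous_map_preimage[OF ga] by blast
  moreover have "topspace K \<times> {a} \<subseteq> W"
  proof clarify
    fix k assume k: "k \<in> topspace K"
    then have "g (k, a) \<in> topspace Y"
      using gY a by simp
    with k a show "(k, a) \<in> W"
      using equiv_class_self[OF eq] unfolding W_def by auto
  qed
  ultimately obtain U N where UN: "openin X N" "topspace K \<subseteq> U" "a \<in> N" "U \<times> N \<subseteq> W"
    using tube_lemma_left[of K X W "topspace K" a] K a by (auto simp: compact_space_def)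
  have "(g (k, a), g (k, b)) \<in> R" if "b \<in> N" "k \<in> topspace K" for b k
  proof -
    have "(k, b) \<in> W"
      using UN that by blast
    then obtain z where "(z, g (k, b)) \<in> R" "(z, g (k, a)) \<in> R"
      unfolding W_def by auto
    then show ?thesis
      using eq unfolding equiv_def by (meson symD transD)
  qed
  with UN show ?thesis
    by blast
qed

text \<open>The classes are an open cover by disjoint nonempty sets. No member of such a cover can
  be omitted, so a finite subcover already contains every class.\<close>

lemma finite_quotient_open_equiv:
  assumes "compact_space X" "open_equiv X R"
  shows "finite (topspace X // R)"
proof -
  have eq: "equiv (topspace X) R"
    using assms(2) by (simp add: open_equiv_def)
  have "\<forall>U\<in>topspace X // R. openin X U"
    using assms(2) by (auto simp: open_equiv_def elim!: quotientE)
  moreover have un: "\<Union> (topspace X // R) = topspace X"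
    by (rule Union_quotient[OF eq])
  ultimately obtain \<F> where F: "finite \<F>" "\<F> \<subseteq> topspace X // R" "\<Union>\<F> = topspace X"
    using assms(1) unfolding compact_space by metis
  have "topspace X // R \<subseteq> \<F>"
  proof
    fix C assume C: "C \<in> topspace X // R"
    then obtain c where c: "c \<in> C"
      using in_quotient_imp_non_empty[OF eq] by blast
    then have "c \<in> topspace X"
      using C un by blast
    then obtain D where D: "D \<in> \<F>" "c \<in> D"
      using F by blast
    then have "C = D"
      using quotient_disj[OF eq C] F c by blast
    with D show "C \<in> \<F>"
      by simp
  qed
  with F show ?thesis
    by (blast intro: finite_subset)
qed

section \<open>Operations and translations modulo an equivalence\<close>

lemma operation_closed:
  assumes "topological_algebra \<Omega> A E" "\<omega> \<in> topspace (\<Omega> n)" "a \<in> {..<n} \<rightarrow>\<^sub>E topspace A"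
  shows "E n \<omega> a \<in> topspace A"
proof -
  have "continuous_map (prod_topology (\<Omega> n) (power_topology A n)) A (\<lambda>(\<omega>, a). E n \<omega> a)"
    using assms(1) by (simp add: topological_algebra_def)
  from funcset_mem[OF continuous_map_funspace[OF this], of "(\<omega>, a)"] assms(2,3) show ?thesis
    by simp
qed

lemma term_eval_closed:
  assumes "topological_algebra \<Omega> A E" "wf_term \<Omega> (topspace A) t" "z \<in> topspace A"
  shows "term_eval E z t \<in> topspace A"
  using assms(2)
proof (induction t)
  case (Op \<omega> ts)
  then show ?case
    unfolding term_eval.simps by (intro operation_closed[OF assms(1)]) auto
qed (use assms(3) in auto)

text \<open>Only single translations of arity exactly \<open>n\<close> are tested, not composites;
  for \<open>n = 0\<close> the test is vacuous. The tuple \<open>c\<close> is full and its entry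
  \<open>i\<close> is overwritten, so that the parameters range over a product space.\<close>

definition translation_kernel ::
    "(nat \<Rightarrow> 'o topology) \<Rightarrow> 'a set \<Rightarrow> ('o, 'a) ops \<Rightarrow> ('a \<times> 'a) set \<Rightarrow> nat \<Rightarrow> ('a \<times> 'a) set" where
  "translation_kernel \<Omega> A E R n = {(a, b). a \<in> A \<and> b \<in> A \<and>
     (\<forall>\<omega>\<in>topspace (\<Omega> n). \<forall>i<n. \<forall>c\<in>{..<n} \<rightarrow>\<^sub>E A. (E n \<omega> (c(i := a)), E n \<omega> (c(i := b))) \<in> R)}"

text \<open>The arguments are exchanged one at a time. Each exchange is an application of a
  translation to \<open>a i\<close> and \<open>b i\<close>, and transitivity of \<open>R\<close>
  joins the \<open>n\<close> steps.\<close>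

lemma operation_respects:
  assumes alg: "topological_algebra \<Omega> A E" and eq: "equiv (topspace A) R"
    and w: "\<omega> \<in> topspace (\<Omega> n)"
    and a: "a \<in> {..<n} \<rightarrow>\<^sub>E topspace A" and b: "b \<in> {..<n} \<rightarrow>\<^sub>E topspace A"
    and ab: "\<And>i. i < n \<Longrightarrow> (a i, b i) \<in> translation_kernel \<Omega> (topspace A) E R n"
  shows "(E n \<omega> a, E n \<omega> b) \<in> R"
proof -
  \<comment> \<open>The hybrid tuples run from \<open>c 0 = a\<close> to \<open>c n = b\<close>;
    consecutive ones differ at most in entry \<open>k\<close>.\<close>
  define c where "c k = (\<lambda>j. if j < k then b j else a j)" for k
  have "(E n \<omega> a, E n \<omega> (c k)) \<in> R" if "k \<le> n" for k
    using that
  proof (induction k)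
    case 0
    have "c 0 = a"
      by (simp add: c_def)
    then show ?case
      using eq operation_closed[OF alg w a] by (auto simp: equiv_def refl_on_def)
  next
    case (Suc k)
    have ck: "c k \<in> {..<n} \<rightarrow>\<^sub>E topspace A"
      using a b by (auto simp: c_def PiE_iff extensional_def)
    have "(E n \<omega> ((c k)(k := a k)), E n \<omega> ((c k)(k := b k))) \<in> R"
      using ab[of k] Suc.prems w ck unfolding translation_kernel_def by auto
    moreover have "(c k)(k := a k) = c k" "(c k)(k := b k) = c (Suc k)"
      by (auto simp: c_def fun_eq_iff less_Suc_eq)
    ultimately have "(E n \<omega> (c k), E n \<omega> (c (Suc k))) \<in> R"
      by simp
    with Suc eq show ?case
      unfolding equiv_def by (meson Suc_leD transD)
  qed
  moreover have "c n = b"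
    using a b by (auto simp: c_def fun_eq_iff PiE_iff extensional_def)
  ultimately show ?thesis
    by (metis order_refl)
qed

text \<open>By Tychonoff the space of parameters \<open>(\<omega>, c)\<close> is compact, so
  \<open>open_equiv_tube\<close> gives a neighbourhood of \<open>a\<close> for each position
  \<open>i\<close> that works for all parameters at once. There are only \<open>n\<close> positions
  to intersect over.\<close>

lemma open_equiv_translation_kernel:
  assumes alg: "topological_algebra \<Omega> A E" and sig: "compact_signature \<Omega>"
    and A: "compact_space A" and R: "open_equiv A R"
  shows "open_equiv A (translation_kernel \<Omega> (topspace A) E R n)"
proof (rule open_equivI)
  have eq: "equiv (topspace A) R"
    using R by (simp add: open_equiv_def)
  have closed: "E n \<omega> (c(i := a)) \<in> topspace A"
    if "\<omega> \<in> topspace (\<Omega> n)" "i < n" "c \<in> {..<n} \<rightarrow>\<^sub>E topspace A" "a \<in> topspace A" for \<omega> i c a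
    using that by (intro operation_closed[OF alg]) (auto simp: PiE_iff extensional_def)
  show "equiv (topspace A) (translation_kernel \<Omega> (topspace A) E R n)"
  proof (rule equivI)
    show "refl_on (topspace A) (translation_kernel \<Omega> (topspace A) E R n)"
      using eq closed by (auto simp: translation_kernel_def refl_on_def equiv_def)
    have "sym R" "trans R"
      using eq by (auto simp: equiv_def)
    then show "sym (translation_kernel \<Omega> (topspace A) E R n)"
      "trans (translation_kernel \<Omega> (topspace A) E R n)"
      unfolding translation_kernel_def
      by (auto intro!: symI transI elim: symE) (rule transE, assumption, blast+)
  qed (auto simp: translation_kernel_def)
  fix a assume a: "a \<in> topspace A"
  let ?K = "prod_topology (\<Omega> n) (power_topology A n)"
  let ?P = "prod_topology ?K A"
  have K: "compact_space ?K"
    using A sig by (simp add: compact_space_prod_topology compact_space_product_topology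
        compact_signature_def)
  have "\<exists>N. openin A N \<and> a \<in> N \<and>
      (\<forall>b\<in>N. \<forall>k\<in>topspace ?K. (E n (fst k) ((snd k)(i := a)), E n (fst k) ((snd k)(i := b))) \<in> R)"
    if i: "i < n" for i
  proof -
    have "continuous_map ?P (power_topology A n) (\<lambda>p. (snd (fst p))(i := snd p))"
    proof -
      have "continuous_map ?P A (\<lambda>p. ((snd (fst p))(i := snd p)) j)" if "j < n" for j
      proof (cases "j = i")
        case True
        then show ?thesis by (simp add: continuous_map_snd)
      next
        case False
        have "continuous_map ?P (power_topology A n) (snd \<circ> fst)"
          by (rule continuous_map_compose[OF continuous_map_fst continuous_map_snd])
        then show ?thesis
          using False \<open>j < n\<close> by (simp add: continuous_map_componentwise o_def)
      qed
      then show ?thesis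
        using i by (auto simp: continuous_map_componentwise extensional_def PiE_iff)
    qed
    moreover have "continuous_map ?P (\<Omega> n) (fst \<circ> fst)"
      by (rule continuous_map_compose[OF continuous_map_fst continuous_map_fst])
    ultimately have "continuous_map ?P ?K (\<lambda>p. (fst (fst p), (snd (fst p))(i := snd p)))"
      by (intro continuous_map_pairedI) (auto simp: o_def)
    then have "continuous_map ?P A ((\<lambda>(\<omega>, a). E n \<omega> a) \<circ>
        (\<lambda>p. (fst (fst p), (snd (fst p))(i := snd p))))"
      by (rule continuous_map_compose) (use alg in \<open>simp add: topological_algebra_def\<close>)
    from open_equiv_tube[OF R K this a] show ?thesis
      by simp
  qed
  then obtain N where N: "\<And>i. i < n \<Longrightarrow> openin A (N i) \<and> a \<in> N i \<and>
      (\<forall>b\<in>N i. \<forall>k\<in>topspace ?K. (E n (fst k) ((snd k)(i := a)), E n (fst k) ((snd k)(i := b))) \<in> R)"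
    by metis
  \<comment> \<open>The factor \<open>topspace A\<close> matters for \<open>n = 0\<close>, where
    there is no \<open>N i\<close> to intersect.\<close>
  define M where "M = topspace A \<inter> (\<Inter>i\<in>{..<n}. N i)"
  have "openin A M"
    unfolding M_def using N by (intro openin_Int_Inter) auto
  moreover have "a \<in> M"
    using N a by (auto simp: M_def)
  moreover have "M \<subseteq> translation_kernel \<Omega> (topspace A) E R n `` {a}"
  proof
    fix b assume b: "b \<in> M"
    have "(E n \<omega> (c(i := a)), E n \<omega> (c(i := b))) \<in> R"
      if "\<omega> \<in> topspace (\<Omega> n)" "i < n" "c \<in> {..<n} \<rightarrow>\<^sub>E topspace A" for \<omega> i c
    proof -
      have "(\<omega>, c) \<in> topspace ?K" "b \<in> N i"
        using that b by (auto simp: M_def)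
      with N[OF \<open>i < n\<close>] show ?thesis
        by fastforce
    qed
    with a b show "b \<in> translation_kernel \<Omega> (topspace A) E R n `` {a}"
      by (auto simp: translation_kernel_def M_def)
  qed
  ultimately show "\<exists>N. openin A N \<and> a \<in> N \<and> N \<subseteq> translation_kernel \<Omega> (topspace A) E R n `` {a}"
    by blast
qed

section \<open>Terms of bounded arity and height\<close>

text \<open>Induction on the height, with \<open>R\<close> arbitrary: if the arguments of the root
  symbol agree modulo a suitable refinement \<open>R'\<close>, the values agree modulo
  \<open>R\<close>, and the arguments have smaller height.\<close>

lemma open_equiv_bounded_terms:
  assumes alg: "topological_algebra \<Omega> A E" and sig: "compact_signature \<Omega>"
    and A: "compact_space A" and R: "open_equiv A R"
  shows "\<exists>S. open_equiv A S \<and>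
    (\<forall>t a b. wf_term \<Omega> (topspace A) t \<longrightarrow> term_arity t \<le> m \<longrightarrow> term_height t \<le> h \<longrightarrow>
       (a, b) \<in> S \<longrightarrow> (term_eval E a t, term_eval E b t) \<in> R)"
  using R
proof (induction h arbitrary: R)
  case 0
  have refl: "z \<in> topspace A \<Longrightarrow> (z, z) \<in> R" for z
    using 0 by (auto simp: open_equiv_def equiv_def refl_on_def)
  have "(term_eval E a t, term_eval E b t) \<in> R"
    if "wf_term \<Omega> (topspace A) t" "term_height t \<le> 0" "(a, b) \<in> R" for t a b
  proof (cases t)
    case (Op \<omega> ts)
    \<comment> \<open>At height 0 the only operations are nullary, and their value does not depend
      on the variable.\<close>
    with that have "ts = []"
      by (simp split: if_splits)
    with Op that show ?thesis
      using operation_closed[OF alg, of \<omega> 0] by (auto intro!: refl simp: restrict_def)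
  qed (use that refl in auto)
  with 0 show ?case
    by blast
next
  case (Suc h)
  \<comment> \<open>The kernels up to \<open>m\<close> cover every root symbol of a term of arity at
    most \<open>m\<close>, and being finitely many they keep the classes open. The factor
    \<open>R\<close> serves the term \<open>Var\<close>, which already has height 0.\<close>
  define R' where "R' = R \<inter> (\<Inter>n\<in>{..m}. translation_kernel \<Omega> (topspace A) E R n)"
  have "open_equiv A R'"
    unfolding R'_def
    using Suc.prems open_equiv_translation_kernel[OF alg sig A] by (intro open_equiv_INT) auto
  from Suc.IH[OF this] obtain S where S: "open_equiv A S"
    and SR: "\<And>t a b. wf_term \<Omega> (topspace A) t \<Longrightarrow> term_arity t \<le> m \<Longrightarrow> term_height t \<le> h \<Longrightarrow>
       (a, b) \<in> S \<Longrightarrow> (term_eval E a t, term_eval E b t) \<in> R'"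
    by blast
  have eq: "equiv (topspace A) R"
    using Suc.prems by (simp add: open_equiv_def)
  have "(term_eval E a t, term_eval E b t) \<in> R"
    if t: "wf_term \<Omega> (topspace A) t" "term_arity t \<le> m" "term_height t \<le> Suc h"
      and ab: "(a, b) \<in> S" for t a b
  proof (cases t)
    case Var
    then show ?thesis
      using SR[of Var a b] ab by (simp add: R'_def)
  next
    case (Const c)
    then show ?thesis
      using eq t by (auto simp: equiv_def refl_on_def)
  next
    case (Op \<omega> ts)
    have abA: "a \<in> topspace A" "b \<in> topspace A"
      using S ab by (auto simp: open_equiv_def dest!: equiv_type)
    have len: "length ts \<le> m" and w: "\<omega> \<in> topspace (\<Omega> (length ts))"
      using t Op by auto
    have arg: "wf_term \<Omega> (topspace A) s" "term_arity s \<le> m" "term_height s \<le> h"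
      if "s \<in> set ts" for s
      using t Op that by (auto split: if_splits)
    have "(E (length ts) \<omega> (\<lambda>i\<in>{..<length ts}. map (term_eval E a) ts ! i),
           E (length ts) \<omega> (\<lambda>i\<in>{..<length ts}. map (term_eval E b) ts ! i)) \<in> R"
    proof (rule operation_respects[OF alg eq w])
      fix i assume i: "i < length ts"
      then have "(term_eval E a (ts ! i), term_eval E b (ts ! i)) \<in> R'"
        using SR arg ab by auto
      then show "((\<lambda>i\<in>{..<length ts}. map (term_eval E a) ts ! i) i,
          (\<lambda>i\<in>{..<length ts}. map (term_eval E b) ts ! i) i)
          \<in> translation_kernel \<Omega> (topspace A) E R (length ts)"
        using i len by (auto simp: R'_def)
    qed (use arg abA in \<open>auto intro!: term_eval_closed[OF alg]\<close>)
    with Op show ?thesis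
      by simp
  qed
  with S show ?case
    by blast
qed

section \<open>The syntactic congruence of a subset\<close>

text \<open>On an algebra this is the coarsest congruence for which \<open>U\<close>, within
  \<open>A\<close>, is a union of classes, as for the syntactic congruence of a formal
  language.\<close>

definition syntactic_congruence ::
    "(nat \<Rightarrow> 'o topology) \<Rightarrow> 'a set \<Rightarrow> ('o, 'a) ops \<Rightarrow> 'a set \<Rightarrow> ('a \<times> 'a) set" where
  "syntactic_congruence \<Omega> A E U =
     {(a, b). a \<in> A \<and> b \<in> A \<and> (\<forall>f\<in>translation_monoid \<Omega> A E. f a \<in> U \<longleftrightarrow> f b \<in> U)}"

lemma equiv_syntactic_congruence: "equiv A (syntactic_congruence \<Omega> A E U)"
  by (rule equivI) (auto simp: syntactic_congruence_def intro!: refl_onI symI transI)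

text \<open>This is the congruence property, one argument at a time. If \<open>T\<close> is a
  translation and \<open>f\<close> lies in the monoid, so does \<open>f\<close> after
  \<open>T\<close>; hence \<open>f\<close> cannot separate \<open>T a\<close> from
  \<open>T b\<close> modulo \<open>U\<close>.\<close>

lemma syntactic_congruence_le_translation_kernel:
  assumes "topological_algebra \<Omega> A E"
  shows "syntactic_congruence \<Omega> (topspace A) E U \<subseteq>
    translation_kernel \<Omega> (topspace A) E (syntactic_congruence \<Omega> (topspace A) E U) n"
proof clarify
  fix a b assume ab: "(a, b) \<in> syntactic_congruence \<Omega> (topspace A) E U"
  then have abA: "a \<in> topspace A" "b \<in> topspace A"
    by (auto simp: syntactic_congruence_def)
  have "(E n \<omega> (c(i := a)), E n \<omega> (c(i := b))) \<in> syntactic_congruence \<Omega> (topspace A) E U"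
    if *: "\<omega> \<in> topspace (\<Omega> n)" "i < n" "c \<in> {..<n} \<rightarrow>\<^sub>E topspace A" for \<omega> i c
  proof -
    \<comment> \<open>\<open>translation_maps\<close> asks for a tuple that is undefined at
      \<open>i\<close>; filling the gap in \<open>d\<close> gives the same tuple as overwriting
      entry \<open>i\<close> of \<open>c\<close>.\<close>
    define d where "d = restrict c ({..<n} - {i})"
    define T where "T = (\<lambda>z\<in>topspace A. E n \<omega> (d(i := z)))"
    have "d(i := z) = c(i := z)" for z
      using * by (auto simp: d_def fun_eq_iff PiE_iff extensional_def)
    then have T: "T z = E n \<omega> (c(i := z))" if "z \<in> topspace A" for z
      using that by (simp add: T_def)
    have "d \<in> {..<n} - {i} \<rightarrow>\<^sub>E topspace A"
      using * by (auto simp: d_def)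
    then have "T \<in> translation_maps \<Omega> (topspace A) E"
      unfolding translation_maps_def mem_Collect_eq T_def using *
      by (intro exI[of _ n] exI[of _ \<omega>] exI[of _ i] exI[of _ d]) simp
    then have "compose (topspace A) f T \<in> translation_monoid \<Omega> (topspace A) E"
      if "f \<in> translation_monoid \<Omega> (topspace A) E" for f
      using that by (blast intro: translation_monoid_mult translation_monoid_gen)
    then have "compose (topspace A) f T a \<in> U \<longleftrightarrow> compose (topspace A) f T b \<in> U"
      if "f \<in> translation_monoid \<Omega> (topspace A) E" for f
      using that ab unfolding syntactic_congruence_def by blast
    then have "f (T a) \<in> U \<longleftrightarrow> f (T b) \<in> U"
      if "f \<in> translation_monoid \<Omega> (topspace A) E" for f
      using that abA by (simp add: compose_eq)
    moreover have "E n \<omega> (c(i := z)) \<in> topspace A" if "z \<in> topspace A" for z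
      using * that by (intro operation_closed[OF assms]) (auto simp: PiE_iff extensional_def)
    ultimately show ?thesis
      using abA by (auto simp: syntactic_congruence_def T)
  qed
  with abA show "(a, b) \<in> translation_kernel \<Omega> (topspace A) E
      (syntactic_congruence \<Omega> (topspace A) E U) n"
    by (simp add: translation_kernel_def)
qed

text \<open>Affine boundedness enters here: each \<open>f\<close> in the monoid is the function of a
  term with arity and height at most \<open>m\<close>, so one open equivalence \<open>S\<close>
  handles all of them and refines the congruence.\<close>

lemma open_equiv_syntactic_congruence:
  assumes alg: "topological_algebra \<Omega> A E" and sig: "compact_signature \<Omega>"
    and A: "compact_space A" and bdd: "affinely_bounded \<Omega> (topspace A) E"
    and U: "openin A U" "closedin A U"
  shows "open_equiv A (syntactic_congruence \<Omega> (topspace A) E U)"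
proof -
  let ?R = "{(a, b). a \<in> topspace A \<and> b \<in> topspace A \<and> (a \<in> U \<longleftrightarrow> b \<in> U)}"
  obtain m where m: "affinely_bounded_by \<Omega> (topspace A) E m"
    using bdd by (auto simp: affinely_bounded_def)
  obtain S where S: "open_equiv A S"
    and SR: "\<And>t a b. wf_term \<Omega> (topspace A) t \<Longrightarrow> term_arity t \<le> m \<Longrightarrow> term_height t \<le> m \<Longrightarrow>
       (a, b) \<in> S \<Longrightarrow> (term_eval E a t, term_eval E b t) \<in> ?R"
    using open_equiv_bounded_terms[OF alg sig A open_equiv_clopen[OF U], of m m] by blast
  have "S \<subseteq> syntactic_congruence \<Omega> (topspace A) E U"
  proof clarify
    fix a b assume ab: "(a, b) \<in> S"
    then have abA: "a \<in> topspace A" "b \<in> topspace A"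
      using S by (auto simp: open_equiv_def dest!: equiv_type)
    have "f a \<in> U \<longleftrightarrow> f b \<in> U" if f: "f \<in> translation_monoid \<Omega> (topspace A) E" for f
    proof -
      obtain t where t: "f = term_function (topspace A) E t" "t \<in> linear_terms \<Omega> (topspace A)"
          "term_arity t \<le> m" "term_height t \<le> m"
        using f m unfolding affinely_bounded_by_def by auto
      with SR[of t a b] ab abA show ?thesis
        by (simp add: term_function_def linear_terms_def)
    qed
    with abA show "(a, b) \<in> syntactic_congruence \<Omega> (topspace A) E U"
      by (simp add: syntactic_congruence_def)
  qed
  with S show ?thesis
    by (intro open_equiv_superset[OF S equiv_syntactic_congruence])
qed

section \<open>Finite discrete quotients\<close>

text \<open>The quotient by \<open>R\<close> is finite by compactness, and the projection to it as a
  discrete space is continuous because the classes are open. The hypothesis \<open>cong\<close>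
  makes the projection a homomorphism.\<close>

lemma open_congruence_finite_quotient:
  assumes alg: "topological_algebra \<Omega> A E" and A: "compact_space A" and R: "open_equiv A R"
    and cong: "\<And>n. R \<subseteq> translation_kernel \<Omega> (topspace A) E R n"
    and xy: "x \<in> topspace A" "y \<in> topspace A" "(x, y) \<notin> R"
  shows "\<exists>(B :: nat set) F \<phi>.
           finite B \<and> topological_algebra \<Omega> (discrete_topology B) F \<and>
           continuous_map A (discrete_topology B) \<phi> \<and>
           algebra_hom \<Omega> (topspace A) E B F \<phi> \<and> \<phi> x \<noteq> \<phi> y"
proof -
  have eq: "equiv (topspace A) R" and op: "\<And>z. z \<in> topspace A \<Longrightarrow> openin A (R `` {z})"
    using R by (auto simp: open_equiv_def)
  define Q where "Q = topspace A // R"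
  define p where "p a = R `` {a}" for a
  \<comment> \<open>Any choice of representatives is continuous, its domain being discrete. So
    \<open>G\<close>, computed on representatives, is a composite of continuous maps.\<close>
  define r where "r C = (SOME a. a \<in> topspace A \<and> p a = C)" for C
  define G where "G n \<omega> b = p (E n \<omega> (\<lambda>i\<in>{..<n}. r (b i)))" for n \<omega> b
  have r: "r C \<in> topspace A \<and> p (r C) = C" if "C \<in> Q" for C
    unfolding r_def by (rule someI_ex) (use that in \<open>auto simp: Q_def p_def elim!: quotientE\<close>)
  have pQ: "p a \<in> Q" if "a \<in> topspace A" for a
    using that by (simp add: p_def Q_def quotientI)
  have p_eq: "p a = p b \<longleftrightarrow> (a, b) \<in> R" if "a \<in> topspace A" "b \<in> topspace A" for a b
    using that eq_equiv_class_iff[OF eq] by (simp add: p_def)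
  have contp: "continuous_map A (discrete_topology Q) p"
    unfolding continuous_map_def
  proof (intro conjI allI impI)
    fix V assume "openin (discrete_topology Q) V"
    show "openin A {a \<in> topspace A. p a \<in> V}"
    proof (subst openin_subopen, intro ballI)
      fix a assume a: "a \<in> {a \<in> topspace A. p a \<in> V}"
      have "p b = p a" "b \<in> topspace A" if "b \<in> R `` {a}" for b
        using that a equiv_type[OF eq] equiv_class_eq[OF eq, of a b] by (auto simp: p_def)
      then have "R `` {a} \<subseteq> {a \<in> topspace A. p a \<in> V}"
        using a by auto
      with a op[of a] equiv_class_self[OF eq, of a]
      show "\<exists>T. openin A T \<and> a \<in> T \<and> T \<subseteq> {a \<in> topspace A. p a \<in> V}"
        by blast
    qed
  qed (use pQ in auto)
  have contr: "continuous_map (discrete_topology Q) A r"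
    using r by simp
  have "continuous_map (prod_topology (\<Omega> n) (power_topology (discrete_topology Q) n))
          (discrete_topology Q) (\<lambda>(\<omega>, b). G n \<omega> b)" for n
  proof -
    let ?P = "prod_topology (\<Omega> n) (power_topology (discrete_topology Q) n)"
    have "continuous_map ?P A (\<lambda>q. r (snd q i))" if "i < n" for i
    proof -
      have "continuous_map ?P (discrete_topology Q) (\<lambda>q. snd q i)"
        using that continuous_map_snd[of "\<Omega> n" "power_topology (discrete_topology Q) n"]
        by (simp add: continuous_map_componentwise)
      from continuous_map_compose[OF this contr] show ?thesis
        by (simp add: o_def)
    qed
    then have "continuous_map ?P (power_topology A n) (\<lambda>q. \<lambda>i\<in>{..<n}. r (snd q i))"
      by (auto simp: continuous_map_componentwise)
    then have "continuous_map ?P (prod_topology (\<Omega> n) (power_topology A n))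
        (\<lambda>q. (fst q, \<lambda>i\<in>{..<n}. r (snd q i)))"
      by (intro continuous_map_pairedI continuous_map_fst)
    then have "continuous_map ?P A ((\<lambda>(\<omega>, a). E n \<omega> a) \<circ> (\<lambda>q. (fst q, \<lambda>i\<in>{..<n}. r (snd q i))))"
      by (rule continuous_map_compose) (use alg in \<open>simp add: topological_algebra_def\<close>)
    from continuous_map_compose[OF this contp] show ?thesis
      by (simp add: o_def G_def case_prod_unfold)
  qed
  then have algG: "topological_algebra \<Omega> (discrete_topology Q) G"
    by (simp add: topological_algebra_def)
  have hom: "algebra_hom \<Omega> (topspace A) E Q G p"
    unfolding algebra_hom_def
  proof (intro conjI allI ballI)
    fix n \<omega> a assume w: "\<omega> \<in> topspace (\<Omega> n)" and a: "a \<in> {..<n} \<rightarrow>\<^sub>E topspace A"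
    define b where "b = (\<lambda>i\<in>{..<n}. r (p (a i)))"
    have aA: "a i \<in> topspace A" if "i < n" for i
      using a that by auto
    have b: "b \<in> {..<n} \<rightarrow>\<^sub>E topspace A"
      using aA r pQ by (auto simp: b_def)
    \<comment> \<open>Each argument is congruent to the representative of its class, so passing to
      representatives does not change the class of the value.\<close>
    have "(a i, b i) \<in> R" if "i < n" for i
      using that r[OF pQ[OF aA[OF that]]] p_eq[of "a i" "b i"] aA by (simp add: b_def)
    then have "(E n \<omega> a, E n \<omega> b) \<in> R"
      using cong by (intro operation_respects[OF alg eq w a b]) blast
    then have "p (E n \<omega> a) = p (E n \<omega> b)"
      by (simp add: p_eq operation_closed[OF alg w] a b)
    moreover have "(\<lambda>i\<in>{..<n}. r ((\<lambda>i\<in>{..<n}. p (a i)) i)) = b"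
      by (auto simp: b_def)
    ultimately show "p (E n \<omega> a) = G n \<omega> (\<lambda>i\<in>{..<n}. p (a i))"
      by (simp add: G_def)
  qed (use pQ in auto)
  have "finite Q"
    unfolding Q_def by (rule finite_quotient_open_equiv[OF A R])
  moreover have "p x \<noteq> p y"
    using xy p_eq by simp
  \<comment> \<open>The carrier \<open>Q\<close> consists of subsets of \<open>A\<close>; it is
    finite, so the algebra can be copied to natural numbers.\<close>
  ultimately show ?thesis
    using algG contp hom xy(1,2) by (intro finite_discrete_algebra_nat) auto
qed

section \<open>Clopen separation and Stone spaces\<close>

text \<open>In a compact Hausdorff space components and quasi-components coincide, and distinct
  quasi-components are separated by clopen sets.\<close>

lemma Stone_space_separation:
  assumes "Stone_space X" "x \<in> topspace X" "y \<in> topspace X" "x \<noteq> y"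
  obtains U where "openin X U" "closedin X U" "x \<in> U" "y \<notin> U"
proof -
  have "\<not> connected_component_of X x y"
    using assms unfolding Stone_space_def totally_disconnected_space_def connected_component_of_def
    by blast
  then have "\<not> quasi_component_of X x y"
    using assms(1) quasi_eq_connected_component_of[of X x] unfolding Stone_space_def by metis
  then show ?thesis
    using assms that unfolding quasi_component_of by blast
qed

text \<open>A clopen set and its complement give the Hausdorff property, and a connected set lies
  within a single quasi-component, which no clopen set splits.\<close>

lemma Stone_space_if_separated:
  assumes comp: "compact_space X"
    and sep: "\<And>x y. x \<in> topspace X \<Longrightarrow> y \<in> topspace X \<Longrightarrow> x \<noteq> y \<Longrightarrow>
      \<exists>U. openin X U \<and> closedin X U \<and> x \<in> U \<and> y \<notin> U"
  shows "Stone_space X"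
  unfolding Stone_space_def
proof (intro conjI comp)
  show "Hausdorff_space X"
    unfolding Hausdorff_space_def
  proof (intro allI impI)
    fix x y assume *: "x \<in> topspace X \<and> y \<in> topspace X \<and> x \<noteq> y"
    then obtain U where "openin X U" "closedin X U" "x \<in> U" "y \<notin> U"
      using sep by blast
    with * show "\<exists>U V. openin X U \<and> openin X V \<and> x \<in> U \<and> y \<in> V \<and> disjnt U V"
      by (intro exI[of _ U] exI[of _ "topspace X - U"]) (auto simp: disjnt_def)
  qed
  have "x = y" if S: "connectedin X S" "x \<in> S" "y \<in> S" for S x y
  proof (rule ccontr)
    assume "x \<noteq> y"
    moreover have "x \<in> topspace X" "y \<in> topspace X"
      using S connectedin_subset_topspace by blast+
    ultimately obtain U where "openin X U" "closedin X U" "x \<in> U" "y \<notin> U"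
      using sep by blast
    moreover have "quasi_component_of X x y"
      using S by (meson connected_component_of_def connected_imp_quasi_component_of)
    ultimately show False
      by (simp add: quasi_component_of)
  qed
  then show "totally_disconnected_space X"
    unfolding totally_disconnected_space_def by blast
qed

lemma profinite_algebra_imp_Stone_space:
  assumes "profinite_algebra \<Omega> A E"
  shows "Stone_space A"
proof (rule Stone_space_if_separated)
  show "compact_space A"
    using assms by (simp add: profinite_algebra_def)
  fix x y assume xy: "x \<in> topspace A" "y \<in> topspace A" "x \<noteq> y"
  obtain B :: "nat set" and \<phi> where phi: "continuous_map A (discrete_topology B) \<phi>" "\<phi> x \<noteq> \<phi> y"
    using assms xy unfolding profinite_algebra_def by blast
  \<comment> \<open>The fibre of \<open>\<phi>\<close> through \<open>x\<close>; intersecting with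
    \<open>B\<close> makes the target set visibly a subset of the discrete space, hence
    clopen.\<close>
  let ?U = "{z \<in> topspace A. \<phi> z \<in> {\<phi> x} \<inter> B}"
  have "openin A ?U" "closedin A ?U"
    by (rule openin_continuous_map_preimage[OF phi(1)], simp,
        rule closedin_continuous_map_preimage[OF phi(1)], simp)
  moreover have "x \<in> ?U" "y \<notin> ?U"
    using xy phi continuous_map_funspace[OF phi(1)] by auto
  ultimately show "\<exists>U. openin A U \<and> closedin A U \<and> x \<in> U \<and> y \<notin> U"
    by blast
qed

theorem theorem4p7:
  fixes \<Omega> :: "nat \<Rightarrow> 'o topology" and A :: "'a topology" and E :: "('o, 'a) ops"
  assumes "continuous_signature \<Omega>"
    and "compact_signature \<Omega>"
    and "topological_algebra \<Omega> A E"
    and "affinely_bounded \<Omega> (topspace A) E"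
  shows "profinite_algebra \<Omega> A E \<longleftrightarrow> Stone_space A"
proof
  assume "profinite_algebra \<Omega> A E"
  then show "Stone_space A"
    by (rule profinite_algebra_imp_Stone_space)
next
  assume Stone: "Stone_space A"
  then have A: "compact_space A"
    by (simp add: Stone_space_def)
  show "profinite_algebra \<Omega> A E"
    unfolding profinite_algebra_def
  proof (intro conjI ballI impI A)
    fix x y assume xy: "x \<in> topspace A" "y \<in> topspace A" "x \<noteq> y"
    obtain U where U: "openin A U" "closedin A U" "x \<in> U" "y \<notin> U"
      using Stone_space_separation[OF Stone xy] by blast
    let ?R = "syntactic_congruence \<Omega> (topspace A) E U"
    \<comment> \<open>The identity belongs to the monoid, so the congruence refines the partition by
      \<open>U\<close>.\<close>
    have "(x, y) \<notin> ?R"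
    proof
      assume "(x, y) \<in> ?R"
      then have "(\<lambda>z\<in>topspace A. z) x \<in> U \<longleftrightarrow> (\<lambda>z\<in>topspace A. z) y \<in> U"
        unfolding syntactic_congruence_def using translation_monoid_one by blast
      with xy U show False
        by simp
    qed
    then show "\<exists>(B :: nat set) F \<phi>.
           finite B \<and> topological_algebra \<Omega> (discrete_topology B) F \<and>
           continuous_map A (discrete_topology B) \<phi> \<and>
           algebra_hom \<Omega> (topspace A) E B F \<phi> \<and> \<phi> x \<noteq> \<phi> y"
      using open_equiv_syntactic_congruence[OF assms(3,2) A assms(4) U(1,2)]
        syntactic_congruence_le_translation_kernel[OF assms(3)]
      by (intro open_congruence_finite_quotient[OF assms(3) A _ _ xy(1,2)])
  qed
qed

end
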